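(* Let $\phi_1$ and $\phi_2$ be propositional formulas over a set of atoms $\mathcal{P}$. The formula $\phi_1 \leftrightarrow \phi_2$ is valid in the logic of here-and-there (i.e. satisfied by every HT-interpretation $\langle H,T\rangle$ over $\mathcal{P}$) if and only if the formula $\sigma^*(\phi_1) \leftrightarrow \sigma^*(\phi_2)$ is satisfied by every classical interpretation $I$ over the alphabet $\mathcal{P} \cup \mathcal{P}'$ such that $I \models \mathcal{A}$.
   Context: Formulas are propositional formulas built from a set $\mathcal{P}$ of atoms and the symbols $\bot, \top, \neg, \land, \lor, \rightarrow$ ($\neg$ is a primitive connective); $F \leftrightarrow G$ abbreviates $(F \rightarrow G) \land (G \rightarrow F)$. An HT-interpretation is an ordered pair $\langle H,T\rangle$ of sets of atoms with $H \subseteq T \subseteq \mathcal{P}$. Satisfaction in the logic of here-and-there is defined recursively: $\langle H,T\rangle \not\models \bot$; $\langle H,T\rangle \models \top$; for $p \in \mathcal{P}$, $\langle H,T\rangle \models p$ iff $p \in H$; $\langle H,T\rangle \models \phi_1 \land \phi_2$ iff $\langle H,T\rangle \models \phi_1$ and $\langle H,T\rangle \models \phi_2$; $\langle H,T\rangle \models \phi_1 \lor \phi_2$ iff $\langle H,T\rangle \models \phi_1$ or $\langle H,T\rangle \models \phi_2$; $\langle H,T\rangle \models \neg\phi$ iff $\langle T,T\rangle \not\models \phi$; $\langle H,T\rangle \models \phi_1 \rightarrow \phi_2$ iff ($\langle H,T\rangle \models \phi_1$ implies $\langle H,T\rangle \models \phi_2$) and ($\langle T,T\rangle \models \phi_1$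 implies $\langle T,T\rangle \models \phi_2$). Let $\mathcal{P}' = \{p' \mid p \in \mathcal{P}\}$ be a set of new atoms, disjoint from $\mathcal{P}$ (with $p \mapsto p'$ injective). For a formula $\phi$ over $\mathcal{P}$, $\phi'$ is the result of replacing every atom $p$ in $\phi$ by $p'$. A classical interpretation over $\mathcal{P} \cup \mathcal{P}'$ is a subset $I \subseteq \mathcal{P} \cup \mathcal{P}'$ (the set of true atoms). Let $\mathcal{A} = \{p \rightarrow p' \mid p \in \mathcal{P}\}$. The transformation $\sigma^*$, from formulas over $\mathcal{P}$ to formulas over $\mathcal{P} \cup \mathcal{P}'$, is defined recursively by: $\sigma^*(\phi) = \phi$ if $\phi \in \mathcal{P} \cup \{\top,\bot\}$; $\sigma^*(\phi_1 \circ \phi_2) = \sigma^*(\phi_1) \circ \sigma^*(\phi_2)$ for $\circ \in \{\land,\lor\}$; $\sigma^*(\neg\psi) = \neg\psi'$; $\sigma^*(\phi_1 \rightarrow \phi_2) = (\sigma^*(\phi_1) \rightarrow \sigma^*(\phi_2)) \land (\phi_1' \rightarrow \phi_2')$. *)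

theory Defs
  imports Main
begin

datatype (atoms: 'a) form =
    Bot  ("\<^bold>\<bottom>")
  | Top  ("\<^bold>\<top>")
  | Atom 'a
  | Neg "'a form"  ("\<^bold>\<not> _" [73] 73)
  | And "'a form" "'a form"  (infixr "\<^bold>\<and>" 72)
  | Or "'a form" "'a form"  (infixr "\<^bold>\<or>" 71)
  | Imp "'a form" "'a form"  (infixr "\<^bold>\<rightarrow>" 70)
for map: map_atoms

abbreviation Iff :: "'a form \<Rightarrow> 'a form \<Rightarrow> 'a form"  (infix "\<^bold>\<leftrightarrow>" 69) where
  "F \<^bold>\<leftrightarrow> G \<equiv> (F \<^bold>\<rightarrow> G) \<^bold>\<and> (G \<^bold>\<rightarrow> F)"

definition formulas_over :: "'a set \<Rightarrow> 'a form set" where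
  "formulas_over V = {\<phi>. atoms \<phi> \<subseteq> V}"


text \<open>A pair is an HT-interpretation only if its first component is a subset of the second;
  the satisfaction relation itself is total on pairs.\<close>

definition ht_interps :: "'a set \<Rightarrow> ('a set \<times> 'a set) set" where
  "ht_interps V = {(H, T). H \<subseteq> T \<and> T \<subseteq> V}"

fun ht_sat :: "'a set \<times> 'a set \<Rightarrow> 'a form \<Rightarrow> bool"  (infix "\<Turnstile>\<^sub>H\<^sub>T" 50) where
  "(H, T) \<Turnstile>\<^sub>H\<^sub>T \<^bold>\<bottom> \<longleftrightarrow> False"
| "(H, T) \<Turnstile>\<^sub>H\<^sub>T \<^bold>\<top> \<longleftrightarrow> True"
| "(H, T) \<Turnstile>\<^sub>H\<^sub>T Atom p \<longleftrightarrow> p \<in> H"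
| "(H, T) \<Turnstile>\<^sub>H\<^sub>T \<phi> \<^bold>\<and> \<psi> \<longleftrightarrow> (H, T) \<Turnstile>\<^sub>H\<^sub>T \<phi> \<and> (H, T) \<Turnstile>\<^sub>H\<^sub>T \<psi>"
| "(H, T) \<Turnstile>\<^sub>H\<^sub>T \<phi> \<^bold>\<or> \<psi> \<longleftrightarrow> (H, T) \<Turnstile>\<^sub>H\<^sub>T \<phi> \<or> (H, T) \<Turnstile>\<^sub>H\<^sub>T \<psi>"
| "(H, T) \<Turnstile>\<^sub>H\<^sub>T \<^bold>\<not> \<phi> \<longleftrightarrow> \<not> (T, T) \<Turnstile>\<^sub>H\<^sub>T \<phi>"
| "(H, T) \<Turnstile>\<^sub>H\<^sub>T \<phi> \<^bold>\<rightarrow> \<psi> \<longleftrightarrow>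
     ((H, T) \<Turnstile>\<^sub>H\<^sub>T \<phi> \<longrightarrow> (H, T) \<Turnstile>\<^sub>H\<^sub>T \<psi>) \<and>
     ((T, T) \<Turnstile>\<^sub>H\<^sub>T \<phi> \<longrightarrow> (T, T) \<Turnstile>\<^sub>H\<^sub>T \<psi>)"

definition ht_valid :: "'a set \<Rightarrow> 'a form \<Rightarrow> bool" where
  "ht_valid V \<phi> \<longleftrightarrow> (\<forall>M \<in> ht_interps V. M \<Turnstile>\<^sub>H\<^sub>T \<phi>)"


primrec cl_sat :: "'a set \<Rightarrow> 'a form \<Rightarrow> bool"  (infix "\<Turnstile>" 50) where
  "I \<Turnstile> \<^bold>\<bottom> \<longleftrightarrow> False"
| "I \<Turnstile> \<^bold>\<top> \<longleftrightarrow> True"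
| "I \<Turnstile> Atom p \<longleftrightarrow> p \<in> I"
| "I \<Turnstile> \<^bold>\<not> \<phi> \<longleftrightarrow> \<not> I \<Turnstile> \<phi>"
| "I \<Turnstile> \<phi> \<^bold>\<and> \<psi> \<longleftrightarrow> I \<Turnstile> \<phi> \<and> I \<Turnstile> \<psi>"
| "I \<Turnstile> \<phi> \<^bold>\<or> \<psi> \<longleftrightarrow> I \<Turnstile> \<phi> \<or> I \<Turnstile> \<psi>"
| "I \<Turnstile> \<phi> \<^bold>\<rightarrow> \<psi> \<longleftrightarrow> (I \<Turnstile> \<phi> \<longrightarrow> I \<Turnstile> \<psi>)"


text \<open>The map \<open>pr\<close> sends an atom \<open>p\<close> to its primed copy \<open>p'\<close>. Atoms and primed atoms share one
  type, so that the primed atoms of \<open>V\<close> are new only under the following condition.\<close>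

definition priming :: "'a set \<Rightarrow> ('a \<Rightarrow> 'a) \<Rightarrow> bool" where
  "priming V pr \<longleftrightarrow> inj_on pr V \<and> V \<inter> pr ` V = {}"

definition prime_axioms :: "'a set \<Rightarrow> ('a \<Rightarrow> 'a) \<Rightarrow> 'a form set" where
  "prime_axioms V pr = {Atom p \<^bold>\<rightarrow> Atom (pr p) | p. p \<in> V}"

primrec sigma_star :: "('a \<Rightarrow> 'a) \<Rightarrow> 'a form \<Rightarrow> 'a form" where
  "sigma_star pr \<^bold>\<bottom> = \<^bold>\<bottom>"
| "sigma_star pr \<^bold>\<top> = \<^bold>\<top>"
| "sigma_star pr (Atom p) = Atom p"
| "sigma_star pr (\<^bold>\<not> \<phi>) = \<^bold>\<not> map_atoms pr \<phi>"
| "sigma_star pr (\<phi> \<^bold>\<and> \<psi>) = sigma_star pr \<phi> \<^bold>\<and> sigma_star pr \<psi>"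
| "sigma_star pr (\<phi> \<^bold>\<or> \<psi>) = sigma_star pr \<phi> \<^bold>\<or> sigma_star pr \<psi>"
| "sigma_star pr (\<phi> \<^bold>\<rightarrow> \<psi>) =
     (sigma_star pr \<phi> \<^bold>\<rightarrow> sigma_star pr \<psi>) \<^bold>\<and> (map_atoms pr \<phi> \<^bold>\<rightarrow> map_atoms pr \<psi>)"

end

theory Submission
  imports Defs
begin

text \<open>Pairs \<open>(H, T)\<close> with \<open>H \<subseteq> T \<subseteq> P\<close> correspond to the models \<open>I = H \<union> pr ` T\<close> of the axioms
  \<open>p \<rightarrow> p'\<close>: unprimed atoms record truth here, primed atoms truth there. Under this correspondence
  \<open>\<phi>'\<close> evaluates \<open>\<phi>\<close> at \<open>(T, T)\<close> and \<open>\<sigma>\<^sup>*(\<phi>)\<close> evaluates it at \<open>(H, T)\<close>. An equivalence is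
  HT-satisfied at \<open>(H, T)\<close> iff its two sides agree at both \<open>(H, T)\<close> and \<open>(T, T)\<close>; the latter pair
  is covered by the model \<open>T \<union> pr ` T\<close>.\<close>

text \<open>At a pair with equal components the two halves of each HT clause coincide, so
  satisfaction is classical truth in T.\<close>

lemma cl_sat_map_atoms:
  assumes "\<And>p. p \<in> atoms \<phi> \<Longrightarrow> pr p \<in> I \<longleftrightarrow> p \<in> T"
  shows "I \<Turnstile> map_atoms pr \<phi> \<longleftrightarrow> (T, T) \<Turnstile>\<^sub>H\<^sub>T \<phi>"
  using assms by (induction \<phi>) auto

lemma cl_sat_sigma_star:
  assumes "\<And>p. p \<in> atoms \<phi> \<Longrightarrow> p \<in> I \<longleftrightarrow> p \<in> H"
    and "\<And>p. p \<in> atoms \<phi> \<Longrightarrow> pr p \<in> I \<longleftrightarrow> p \<in> T"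
  shows "I \<Turnstile> sigma_star pr \<phi> \<longleftrightarrow> (H, T) \<Turnstile>\<^sub>H\<^sub>T \<phi>"
  using assms by (induction \<phi>) (auto simp: cl_sat_map_atoms)

text \<open>The conditions at (T, T) are absorbed by the quantifier, since (T, T) is itself an
  HT-interpretation.\<close>

lemma ht_valid_Iff:
  "ht_valid V (\<phi> \<^bold>\<leftrightarrow> \<psi>) \<longleftrightarrow>
    (\<forall>H T. H \<subseteq> T \<longrightarrow> T \<subseteq> V \<longrightarrow> ((H, T) \<Turnstile>\<^sub>H\<^sub>T \<phi> \<longleftrightarrow> (H, T) \<Turnstile>\<^sub>H\<^sub>T \<psi>))"
  by (auto simp: ht_valid_def ht_interps_def)

theorem theorem2:
  fixes P :: "'a set" and pr :: "'a \<Rightarrow> 'a" and \<phi>\<^sub>1 \<phi>\<^sub>2 :: "'a form"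
  assumes "priming P pr"
    and "\<phi>\<^sub>1 \<in> formulas_over P" and "\<phi>\<^sub>2 \<in> formulas_over P"
  shows "ht_valid P (\<phi>\<^sub>1 \<^bold>\<leftrightarrow> \<phi>\<^sub>2) \<longleftrightarrow>
    (\<forall>I. I \<subseteq> P \<union> pr ` P \<longrightarrow> (\<forall>\<psi> \<in> prime_axioms P pr. I \<Turnstile> \<psi>) \<longrightarrow>
      I \<Turnstile> (sigma_star pr \<phi>\<^sub>1 \<^bold>\<leftrightarrow> sigma_star pr \<phi>\<^sub>2))"
    (is "_ \<longleftrightarrow> ?classical")
proof
  have at: "atoms \<phi>\<^sub>1 \<subseteq> P" "atoms \<phi>\<^sub>2 \<subseteq> P"
    using assms(2,3) by (auto simp: formulas_over_def)
  show ?classical if valid: "ht_valid P (\<phi>\<^sub>1 \<^bold>\<leftrightarrow> \<phi>\<^sub>2)"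
  proof (intro allI impI)
    fix I
    assume "\<forall>\<psi> \<in> prime_axioms P pr. I \<Turnstile> \<psi>"
    define H T where "H = I \<inter> P" and "T = {p \<in> P. pr p \<in> I}"
    \<comment> \<open>The axioms p \<rightarrow> p' say exactly that H \<subseteq> T.\<close>
    have "H \<subseteq> T" "T \<subseteq> P"
      using \<open>\<forall>\<psi> \<in> prime_axioms P pr. I \<Turnstile> \<psi>\<close> by (auto simp: H_def T_def prime_axioms_def)
    with valid have "(H, T) \<Turnstile>\<^sub>H\<^sub>T \<phi>\<^sub>1 \<longleftrightarrow> (H, T) \<Turnstile>\<^sub>H\<^sub>T \<phi>\<^sub>2"
      by (simp add: ht_valid_Iff)
    moreover have "I \<Turnstile> sigma_star pr \<phi> \<longleftrightarrow> (H, T) \<Turnstile>\<^sub>H\<^sub>T \<phi>" if "atoms \<phi> \<subseteq> P" for \<phi>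
      using that by (intro cl_sat_sigma_star) (auto simp: H_def T_def)
    ultimately show "I \<Turnstile> (sigma_star pr \<phi>\<^sub>1 \<^bold>\<leftrightarrow> sigma_star pr \<phi>\<^sub>2)"
      using at by simp
  qed
  show "ht_valid P (\<phi>\<^sub>1 \<^bold>\<leftrightarrow> \<phi>\<^sub>2)" if classical: ?classical
    unfolding ht_valid_Iff
  proof (intro allI impI)
    fix H T
    assume "H \<subseteq> T" "T \<subseteq> P"
    define I where "I = H \<union> pr ` T"
    have inj: "inj_on pr P" and disj: "P \<inter> pr ` P = {}"
      using assms(1) by (auto simp: priming_def)
    have mem: "p \<in> I \<longleftrightarrow> p \<in> H" "pr p \<in> I \<longleftrightarrow> p \<in> T" if "p \<in> P" for p
      using that \<open>H \<subseteq> T\<close> \<open>T \<subseteq> P\<close> disj inj_on_image_mem_iff[OF inj that \<open>T \<subseteq> P\<close>]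
      by (auto simp: I_def)
    have "I \<subseteq> P \<union> pr ` P"
      using \<open>H \<subseteq> T\<close> \<open>T \<subseteq> P\<close> by (auto simp: I_def)
    moreover have "\<forall>\<psi> \<in> prime_axioms P pr. I \<Turnstile> \<psi>"
      using \<open>H \<subseteq> T\<close> by (auto simp: prime_axioms_def mem)
    ultimately have "I \<Turnstile> (sigma_star pr \<phi>\<^sub>1 \<^bold>\<leftrightarrow> sigma_star pr \<phi>\<^sub>2)"
      using classical by blast
    moreover have "I \<Turnstile> sigma_star pr \<phi> \<longleftrightarrow> (H, T) \<Turnstile>\<^sub>H\<^sub>T \<phi>" if "atoms \<phi> \<subseteq> P" for \<phi>
      using that by (intro cl_sat_sigma_star) (auto simp: mem)
    ultimately show "(H, T) \<Turnstile>\<^sub>H\<^sub>T \<phi>\<^sub>1 \<longleftrightarrow> (H, T) \<Turnstile>\<^sub>H\<^sub>T \<phi>\<^sub>2"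
      using at by auto
  qed
qed

end
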